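(* Let $\mathcal C$ be a category, let $\{[N_i,d_i]\}_{i\in I}$ be a center in $\mathcal C$, and let $\mathcal C'=\mathcal C\left[\{(d_i)^{-1}\circ N_i\}_{i\in I}\right]$ be the dilatation of $\mathcal C$ with this center. Then: (i) There is a canonical functor $\Theta:\mathcal C\to\mathcal C'$ defined by $\Theta(X)=X$ on objects and $\Theta(a)=[X\xrightarrow{a}Y]$ for each morphism $a:X\to Y$ of $\mathcal C$. (ii) For any $i\in I$ and any $n\in N_i$, there exists a unique morphism $b:dom(n)\to dom(d_i)$ in $\mathcal C'$ such that $[d_i]\circ b=[n]$ in $\mathcal C'$. Moreover $b=[dom(n)\xrightarrow{n}cod(n)\xrightarrow{l_{d_i}}dom(d_i)]$.
   Context: A sieve in $\mathcal C$ is a collection of morphisms stable under precomposition; a sieve over an object $Y$ is a sieve all of whose morphisms have codomain $Y$. Localization. For a collection $\Sigma$ of morphisms of $\mathcal C$, let $\mathcal G$ be the directed graph whose vertices are the objects of $\mathcal C$ and whose directed lines are: a line $a:dom(a)\to cod(a)$ for each morphism $a$ of $\mathcal C$, and a line $l_d:cod(d)\to dom(d)$ for each $d\in\Sigma$. A $\Sigma$-sequence is a finite, possibly empty, path of composable directed lines of $\mathcal G$ (an empty sequence is given by an object). Two $\Sigma$-sequences with the same domain and codomain are equivalent if they are related by a chain of replacements of consecutive parts (written in order of traversal): $X\xrightarrow{a}Y\xrightarrow{a'}Z \leftrightsquigarrow X\xrightarrow{a'\circ a}Z$ for $a,a'\in Mor\,\mathcal C$; $l_d,d\leftrightsquigarrow$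 empty and $d,l_d\leftrightsquigarrow$ empty for $d\in\Sigma$; $Id_X\leftrightsquigarrow$ empty sequence at $X$. The class of $s$ is denoted $[s]$; a $\Sigma$-fraction is such a class. The localization $\mathcal C[\Sigma^{-1}]$ has the objects of $\mathcal C$ as objects and $\Sigma$-fractions as morphisms (composed by concatenation). Dilatation. A center in $\mathcal C$ is a collection $\{[N_i,d_i]\}_{i\in I}$ where each $d_i$ is a morphism of $\mathcal C$ and $N_i$ is a sieve over $cod(d_i)$. Put $\Sigma=\{d_i\}_{i\in I}$. A $\{[N_i,d_i]\}_{i\in I}$-fraction is a $\Sigma$-fraction having a representative of the form $X_1\xrightarrow{n_1}Y_1\xrightarrow{l_{d_{i_1}}}X_2\xrightarrow{n_2}Y_2\xrightarrow{l_{d_{i_2}}}X_3\cdots X_k\xrightarrow{n_k}Y_k\xrightarrow{l_{d_{i_k}}}X_{k+1}\xrightarrow{a}X_{k+2}$ with $a\in Mor\,\mathcal C$, $k\ge 0$, $i_j\in I$ and $n_j\in N_{i_j}$ for all $j$. The dilatation $\mathcal C\left[\{(d_i)^{-1}\circ N_i\}_{i\in I}\right]$ is the category with the same objects as $\mathcal C$ and with $\{[N_i,d_i]\}_{i\in I}$-fractions as morphisms (composed by concatenation). *)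

theory Defs
  imports Main
begin

section \<open>Categories and functors\<close>

record ('o, 'm) cat =
  Obj :: "'o set"
  Mor :: "'m set"
  Dom :: "'m \<Rightarrow> 'o"
  Cod :: "'m \<Rightarrow> 'o"
  Ident :: "'o \<Rightarrow> 'm"
  Comp :: "'m \<Rightarrow> 'm \<Rightarrow> 'm"  (infixl "\<cdot>\<index>" 70)

definition Hom :: "('o, 'm) cat \<Rightarrow> 'o \<Rightarrow> 'o \<Rightarrow> 'm set" where
  "Hom C X Y = {f \<in> Mor C. Dom C f = X \<and> Cod C f = Y}"

text \<open>\<open>g \<cdot>\<^bsub>C\<^esub> f\<close> means \<open>g\<close> after \<open>f\<close>; it is only meaningful when \<open>Cod C f = Dom C g\<close>.\<close>

locale category =
  fixes C :: "('o, 'm) cat" (structure)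
  assumes Dom_in_Obj: "f \<in> Mor C \<Longrightarrow> Dom C f \<in> Obj C"
    and Cod_in_Obj: "f \<in> Mor C \<Longrightarrow> Cod C f \<in> Obj C"
    and Ident_in_Hom: "X \<in> Obj C \<Longrightarrow> Ident C X \<in> Hom C X X"
    and Comp_in_Hom: "f \<in> Hom C X Y \<Longrightarrow> g \<in> Hom C Y Z \<Longrightarrow> g \<cdot> f \<in> Hom C X Z"
    and Comp_Ident: "f \<in> Hom C X Y \<Longrightarrow> f \<cdot> Ident C X = f"
    and Ident_Comp: "f \<in> Hom C X Y \<Longrightarrow> Ident C Y \<cdot> f = f"
    and Comp_assoc: "f \<in> Hom C W X \<Longrightarrow> g \<in> Hom C X Y \<Longrightarrow> h \<in> Hom C Y Z
      \<Longrightarrow> (h \<cdot> g) \<cdot> f = h \<cdot> (g \<cdot> f)"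

locale cat_functor = source: category C + target: category D
  for C :: "('o, 'm) cat" and D :: "('p, 'n) cat" +
  fixes F_obj :: "'o \<Rightarrow> 'p" and F_mor :: "'m \<Rightarrow> 'n"
  assumes obj_map: "X \<in> Obj C \<Longrightarrow> F_obj X \<in> Obj D"
    and mor_map: "f \<in> Hom C X Y \<Longrightarrow> F_mor f \<in> Hom D (F_obj X) (F_obj Y)"
    and map_Ident: "X \<in> Obj C \<Longrightarrow> F_mor (Ident C X) = Ident D (F_obj X)"
    and map_Comp: "f \<in> Hom C X Y \<Longrightarrow> g \<in> Hom C Y Z
      \<Longrightarrow> F_mor (g \<cdot>\<^bsub>C\<^esub> f) = F_mor g \<cdot>\<^bsub>D\<^esub> F_mor f"

section \<open>Sieves and centers\<close>

definition sieve :: "('o, 'm) cat \<Rightarrow> 'm set \<Rightarrow> bool" where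
  "sieve C S \<longleftrightarrow> S \<subseteq> Mor C \<and>
    (\<forall>f\<in>S. \<forall>g\<in>Mor C. Cod C g = Dom C f \<longrightarrow> f \<cdot>\<^bsub>C\<^esub> g \<in> S)"

definition sieve_over :: "('o, 'm) cat \<Rightarrow> 'o \<Rightarrow> 'm set \<Rightarrow> bool" where
  "sieve_over C Y S \<longleftrightarrow> sieve C S \<and> (\<forall>f\<in>S. Cod C f = Y)"

definition center :: "('o, 'm) cat \<Rightarrow> 'i set \<Rightarrow> ('i \<Rightarrow> 'm set) \<Rightarrow> ('i \<Rightarrow> 'm) \<Rightarrow> bool" where
  "center C I N d \<longleftrightarrow> (\<forall>i\<in>I. d i \<in> Mor C \<and> sieve_over C (Cod C (d i)) (N i))"

section \<open>Localization\<close>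

text \<open>\<open>Inv d\<close> is the formal line \<open>l\<^sub>d\<close>, running opposite to \<open>d\<close>.\<close>

datatype 'm line = Arr 'm | Inv 'm

definition lines :: "('o, 'm) cat \<Rightarrow> 'm set \<Rightarrow> 'm line set" where
  "lines C \<Sigma> = Arr ` Mor C \<union> Inv ` \<Sigma>"

primrec line_source :: "('o, 'm) cat \<Rightarrow> 'm line \<Rightarrow> 'o" where
  "line_source C (Arr a) = Dom C a"
| "line_source C (Inv d) = Cod C d"

primrec line_target :: "('o, 'm) cat \<Rightarrow> 'm line \<Rightarrow> 'o" where
  "line_target C (Arr a) = Cod C a"
| "line_target C (Inv d) = Dom C d"

primrec path :: "('o, 'm) cat \<Rightarrow> 'm set \<Rightarrow> 'o \<Rightarrow> 'm line list \<Rightarrow> 'o \<Rightarrow> bool" where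
  "path C \<Sigma> X [] Y \<longleftrightarrow> X \<in> Obj C \<and> X = Y"
| "path C \<Sigma> X (l # ls) Y \<longleftrightarrow>
    l \<in> lines C \<Sigma> \<and> line_source C l = X \<and> path C \<Sigma> (line_target C l) ls Y"

text \<open>A sequence is stored as (domain, lines in order of traversal, codomain), so that the empty
  sequence at \<open>X\<close> is \<open>(X, [], X)\<close>.\<close>

type_synonym ('o, 'm) seq = "'o \<times> 'm line list \<times> 'o"

definition sequences :: "('o, 'm) cat \<Rightarrow> 'm set \<Rightarrow> ('o, 'm) seq set" where
  "sequences C \<Sigma> = {(X, ls, Y). path C \<Sigma> X ls Y}"

inductive replacement :: "('o, 'm) cat \<Rightarrow> 'm set \<Rightarrow> 'm line list \<Rightarrow> 'm line list \<Rightarrow> bool"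
  for C :: "('o, 'm) cat" and \<Sigma> :: "'m set" where
  compose: "a \<in> Mor C \<Longrightarrow> a' \<in> Mor C \<Longrightarrow> Cod C a = Dom C a'
    \<Longrightarrow> replacement C \<Sigma> [Arr a, Arr a'] [Arr (a' \<cdot>\<^bsub>C\<^esub> a)]"
| cancel_left: "d \<in> \<Sigma> \<Longrightarrow> replacement C \<Sigma> [Inv d, Arr d] []"
| cancel_right: "d \<in> \<Sigma> \<Longrightarrow> replacement C \<Sigma> [Arr d, Inv d] []"
| drop_Ident: "X \<in> Obj C \<Longrightarrow> replacement C \<Sigma> [Arr (Ident C X)] []"

definition replace_step :: "('o, 'm) cat \<Rightarrow> 'm set \<Rightarrow> ('o, 'm) seq rel" where
  "replace_step C \<Sigma> = {((X, p @ u @ q, Y), (X, p @ v @ q, Y)) | X p u v q Y.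
    replacement C \<Sigma> u v \<and> path C \<Sigma> X (p @ u @ q) Y \<and> path C \<Sigma> X (p @ v @ q) Y}"

definition seq_equiv :: "('o, 'm) cat \<Rightarrow> 'm set \<Rightarrow> ('o, 'm) seq rel" where
  "seq_equiv C \<Sigma> = {(s, t). s \<in> sequences C \<Sigma> \<and> t \<in> sequences C \<Sigma> \<and>
    (s, t) \<in> (replace_step C \<Sigma> \<union> (replace_step C \<Sigma>)\<inverse>)\<^sup>*}"

definition seq_class :: "('o, 'm) cat \<Rightarrow> 'm set \<Rightarrow> ('o, 'm) seq \<Rightarrow> ('o, 'm) seq set" where
  "seq_class C \<Sigma> s = seq_equiv C \<Sigma> `` {s}"

definition fractions :: "('o, 'm) cat \<Rightarrow> 'm set \<Rightarrow> ('o, 'm) seq set set" where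
  "fractions C \<Sigma> = sequences C \<Sigma> // seq_equiv C \<Sigma>"

text \<open>All members of a class share their domain and codomain, and the class of a concatenation does
  not depend on the representatives; so \<open>THE\<close> and the union below are well defined on composable
  fractions.\<close>

definition localization :: "('o, 'm) cat \<Rightarrow> 'm set \<Rightarrow> ('o, ('o, 'm) seq set) cat" where
  "localization C \<Sigma> =
    \<lparr> Obj = Obj C,
      Mor = fractions C \<Sigma>,
      Dom = (\<lambda>F. THE X. \<exists>ls Y. (X, ls, Y) \<in> F),
      Cod = (\<lambda>F. THE Y. \<exists>X ls. (X, ls, Y) \<in> F),
      Ident = (\<lambda>X. seq_class C \<Sigma> (X, [], X)),
      Comp = (\<lambda>G F. \<Union>(X, ls, Y)\<in>F. \<Union>(Y', ls', Z)\<in>G. seq_class C \<Sigma> (X, ls @ ls', Z)) \<rparr>"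

section \<open>Dilatation\<close>

text \<open>The list \<open>ps\<close> consists of the pairs \<open>(i\<^sub>j, n\<^sub>j)\<close>; membership in \<^const>\<open>sequences\<close> is what makes
  consecutive lines composable.\<close>

definition center_sequences ::
  "('o, 'm) cat \<Rightarrow> 'i set \<Rightarrow> ('i \<Rightarrow> 'm set) \<Rightarrow> ('i \<Rightarrow> 'm) \<Rightarrow> ('o, 'm) seq set" where
  "center_sequences C I N d = sequences C (d ` I) \<inter>
    {(X, concat (map (\<lambda>(i, n). [Arr n, Inv (d i)]) ps) @ [Arr a], Y) | X ps a Y.
      set ps \<subseteq> (SIGMA i:I. N i) \<and> a \<in> Mor C}"

definition dilatation ::
  "('o, 'm) cat \<Rightarrow> 'i set \<Rightarrow> ('i \<Rightarrow> 'm set) \<Rightarrow> ('i \<Rightarrow> 'm) \<Rightarrow> ('o, ('o, 'm) seq set) cat" where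
  "dilatation C I N d = (localization C (d ` I))
    \<lparr> Mor := {F \<in> fractions C (d ` I). \<exists>s\<in>F. s \<in> center_sequences C I N d} \<rparr>"

definition mor_class :: "('o, 'm) cat \<Rightarrow> 'm set \<Rightarrow> 'm \<Rightarrow> ('o, 'm) seq set" where
  "mor_class C \<Sigma> a = seq_class C \<Sigma> (Dom C a, [Arr a], Cod C a)"

end

theory Submission
  imports Defs
begin

text \<open>In the localization every \<open>d \<in> \<Sigma>\<close> becomes invertible with inverse \<open>[l\<^sub>d]\<close>, so \<open>[d] \<circ> b = [n]\<close>
  forces \<open>b = [l\<^sub>d] \<circ> [n]\<close>, which is the class of the sequence \<open>n, l\<^sub>d\<close> and hence lies in the dilatation.
  The dilatation is closed under composition because the trailing arrow \<open>a\<close> of one representative can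
  be merged with the first \<open>n\<close> of the next one, the \<open>N\<^sub>i\<close> being stable under precomposition.\<close>

section \<open>The localization is a category\<close>

text \<open>The unit and associativity laws speak only of elements of hom-sets, so they survive
  passing to a smaller set of morphisms; closure is all that must be supplied. This will exhibit the
  dilatation as a subcategory of the localization with the same objects.\<close>

lemma category_if_contains_Ident_and_Comp:
  assumes "category C" "M \<subseteq> Mor C"
    and id: "\<And>X. X \<in> Obj C \<Longrightarrow> Ident C X \<in> M"
    and comp: "\<And>f g. f \<in> M \<Longrightarrow> g \<in> M \<Longrightarrow> Cod C f = Dom C g \<Longrightarrow> g \<cdot>\<^bsub>C\<^esub> f \<in> M"
  shows "category (C\<lparr>Mor := M\<rparr>)"
proof -
  interpret category C by fact
  have Hom: "f \<in> Hom (C\<lparr>Mor := M\<rparr>) X Y \<longleftrightarrow> f \<in> Hom C X Y \<and> f \<in> M" for f X Y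
    using \<open>M \<subseteq> Mor C\<close> by (auto simp: Hom_def)
  show ?thesis
  proof (standard, goal_cases)
    case (4 f X Y g Z)
    then have "g \<cdot>\<^bsub>C\<^esub> f \<in> M"
      by (intro comp) (auto simp: Hom_def)
    with 4 show ?case
      by (auto simp: Hom intro: Comp_in_Hom)
  qed (use assms Ident_in_Hom in \<open>auto simp: Hom subset_iff Dom_in_Obj Cod_in_Obj Comp_Ident Ident_Comp
        intro: Comp_assoc\<close>)
qed

locale localizing = category C for C :: "('o, 'm) cat" (structure) +
  fixes \<Sigma> :: "'m set"
  assumes Sigma_Mor: "\<Sigma> \<subseteq> Mor C"
begin

abbreviation cls :: "'o \<Rightarrow> 'm line list \<Rightarrow> 'o \<Rightarrow> ('o, 'm) seq set" where
  "cls X ls Y \<equiv> seq_class C \<Sigma> (X, ls, Y)"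

abbreviation L :: "('o, ('o, 'm) seq set) cat" where
  "L \<equiv> localization C \<Sigma>"

section \<open>Endpoints and concatenation of paths\<close>

lemma line_in_Obj:
  assumes "l \<in> lines C \<Sigma>"
  shows "line_source C l \<in> Obj C" "line_target C l \<in> Obj C"
  using assms Sigma_Mor by (auto simp: lines_def intro!: Dom_in_Obj Cod_in_Obj)

lemma path_in_Obj:
  assumes "path C \<Sigma> X ls Y"
  shows "X \<in> Obj C" "Y \<in> Obj C"
  using assms by (induction ls arbitrary: X) (auto simp: line_in_Obj)

lemma path_append:
  "path C \<Sigma> X (ls @ ms) Z \<longleftrightarrow> (\<exists>Y. path C \<Sigma> X ls Y \<and> path C \<Sigma> Y ms Z)"
  by (induction ls arbitrary: X) (auto dest: path_in_Obj)

lemma path_Arr: "a \<in> Hom C X Y \<Longrightarrow> path C \<Sigma> X [Arr a] Y"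
  by (auto simp: Hom_def lines_def intro: Cod_in_Obj)

lemma path_Inv: "d \<in> \<Sigma> \<Longrightarrow> path C \<Sigma> (Cod C d) [Inv d] (Dom C d)"
  using Sigma_Mor by (auto simp: lines_def intro: Dom_in_Obj)

text \<open>Each rule preserves both endpoints. The converse fails in general: the empty list is a
  path at every object, while a cancelling pair fits only at one. This is why
  \<open>replace_step\<close> demands a path on both sides.\<close>

lemma path_replacement:
  assumes "replacement C \<Sigma> u v" "path C \<Sigma> X u Y"
  shows "path C \<Sigma> X v Y"
  using assms
proof cases
  case (compose a a')
  then have "a' \<cdot> a \<in> Hom C (Dom C a) (Cod C a')"
    by (intro Comp_in_Hom[of _ _ "Cod C a"]) (auto simp: Hom_def)
  with compose assms show ?thesis
    by (auto simp: Hom_def lines_def)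
next
  case (drop_Ident x)
  with assms Ident_in_Hom[of x] show ?thesis
    by (auto simp: Hom_def)
qed (use assms Sigma_Mor in \<open>auto dest: line_in_Obj\<close>)

section \<open>Replacement and equivalence inside a longer path\<close>

lemma path_replacement_context:
  assumes "replacement C \<Sigma> u v" "path C \<Sigma> X (p @ u @ q) Y"
  shows "path C \<Sigma> X (p @ v @ q) Y"
  using assms(2) path_replacement[OF assms(1)] unfolding path_append by blast

text \<open>The lines around the replaced part merely grow by \<open>p\<close> on the left and
  \<open>q\<close> on the right. The target \<open>t\<close> is left arbitrary and its endpoints are
  part of the conclusion, so that the statement can be iterated along a chain of steps.\<close>

lemma replace_step_context:
  assumes "((X, ls, Y), t) \<in> replace_step C \<Sigma> \<union> (replace_step C \<Sigma>)\<inverse>"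
    and "path C \<Sigma> W p X" "path C \<Sigma> Y q Z"
  shows "\<exists>ms. t = (X, ms, Y) \<and>
    ((W, p @ ls @ q, Z), (W, p @ ms @ q, Z)) \<in> replace_step C \<Sigma> \<union> (replace_step C \<Sigma>)\<inverse>"
proof -
  have ctx: "((W, p @ (p' @ u @ q') @ q, Z), (W, p @ (p' @ v @ q') @ q, Z)) \<in> replace_step C \<Sigma>"
    if "replacement C \<Sigma> u v" "path C \<Sigma> X (p' @ u @ q') Y" "path C \<Sigma> X (p' @ v @ q') Y" for p' u v q'
  proof -
    have "path C \<Sigma> W (p @ (p' @ u @ q') @ q) Z" "path C \<Sigma> W (p @ (p' @ v @ q') @ q) Z"
      using that assms(2,3) path_append by blast+
    \<comment> \<open>Rebracketing exposes \<open>p @ p'\<close> and \<open>q' @ q\<close> as the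
      new surroundings of \<open>u\<close> and \<open>v\<close>, the shape required by
      \<open>replace_step\<close>.\<close>
    then have "path C \<Sigma> W ((p @ p') @ u @ (q' @ q)) Z" "path C \<Sigma> W ((p @ p') @ v @ (q' @ q)) Z"
      by simp_all
    with that(1) have "((W, (p @ p') @ u @ (q' @ q), Z), (W, (p @ p') @ v @ (q' @ q), Z)) \<in> replace_step C \<Sigma>"
      unfolding replace_step_def by blast
    then show ?thesis by simp
  qed
  from assms(1) consider
      (fwd) p' u v q' where "ls = p' @ u @ q'" "t = (X, p' @ v @ q', Y)" "replacement C \<Sigma> u v"
        "path C \<Sigma> X (p' @ u @ q') Y" "path C \<Sigma> X (p' @ v @ q') Y"
    | (bwd) p' u v q' where "ls = p' @ v @ q'" "t = (X, p' @ u @ q', Y)" "replacement C \<Sigma> u v"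
        "path C \<Sigma> X (p' @ u @ q') Y" "path C \<Sigma> X (p' @ v @ q') Y"
    unfolding replace_step_def by blast
  then show ?thesis
    by cases (use ctx in blast)+
qed

text \<open>Induction along the chain of steps. Besides the congruence, it records that equivalent
  sequences have equal endpoints.\<close>

lemma seq_equiv_context:
  assumes "((X, ls, Y), t) \<in> seq_equiv C \<Sigma>" "path C \<Sigma> W p X" "path C \<Sigma> Y q Z"
  shows "\<exists>ms. t = (X, ms, Y) \<and> ((W, p @ ls @ q, Z), (W, p @ ms @ q, Z)) \<in> seq_equiv C \<Sigma>"
proof -
  let ?R = "replace_step C \<Sigma> \<union> (replace_step C \<Sigma>)\<inverse>"
  have "((X, ls, Y), t) \<in> ?R\<^sup>*"
    using assms by (simp add: seq_equiv_def)
  then have "\<exists>ms. t = (X, ms, Y) \<and> ((W, p @ ls @ q, Z), (W, p @ ms @ q, Z)) \<in> ?R\<^sup>*"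
  proof (induction t)
    case (step t t')
    then obtain ms where "t = (X, ms, Y)" "((W, p @ ls @ q, Z), (W, p @ ms @ q, Z)) \<in> ?R\<^sup>*"
      by blast
    with replace_step_context[of X ms Y t'] assms(2,3) step.hyps(2) show ?case
      by (meson rtrancl.rtrancl_into_rtrancl)
  qed simp
  moreover have "path C \<Sigma> X ls Y" "t \<in> sequences C \<Sigma>"
    using assms by (auto simp: seq_equiv_def sequences_def)
  ultimately show ?thesis
    using assms(2,3) by (fastforce simp: seq_equiv_def sequences_def path_append)
qed

text \<open>Symmetry holds because the converse steps are adjoined before the reflexive transitive
  closure is taken.\<close>

lemma equiv_seq_equiv: "equiv (sequences C \<Sigma>) (seq_equiv C \<Sigma>)"
proof (rule equivI)
  let ?R = "replace_step C \<Sigma> \<union> (replace_step C \<Sigma>)\<inverse>"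
  have "sym (?R\<^sup>*)"
    by (intro sym_rtrancl) (auto simp: sym_def)
  then show "sym (seq_equiv C \<Sigma>)"
    by (auto simp: seq_equiv_def sym_def)
  show "trans (seq_equiv C \<Sigma>)"
    by (auto simp: seq_equiv_def trans_def intro: rtrancl_trans)
qed (auto simp: seq_equiv_def refl_on_def)

section \<open>Classes of sequences and their composition\<close>

lemma cls_eq_iff:
  assumes "path C \<Sigma> X ls Y" "path C \<Sigma> X' ms Y'"
  shows "cls X ls Y = cls X' ms Y' \<longleftrightarrow> ((X, ls, Y), (X', ms, Y')) \<in> seq_equiv C \<Sigma>"
  unfolding seq_class_def
  using assms by (intro eq_equiv_class_iff[OF equiv_seq_equiv]) (auto simp: sequences_def)

lemma cls_self: "path C \<Sigma> X ls Y \<Longrightarrow> (X, ls, Y) \<in> cls X ls Y"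
  by (simp add: seq_class_def seq_equiv_def sequences_def)

lemma cls_context:
  assumes "cls X ls Y = cls X ms Y" "path C \<Sigma> X ls Y" "path C \<Sigma> X ms Y"
    and "path C \<Sigma> W p X" "path C \<Sigma> Y q Z"
  shows "cls W (p @ ls @ q) Z = cls W (p @ ms @ q) Z"
proof -
  have "((W, p @ ls @ q, Z), (W, p @ ms @ q, Z)) \<in> seq_equiv C \<Sigma>"
    using seq_equiv_context[of X ls Y "(X, ms, Y)"] assms by (auto simp: cls_eq_iff)
  then show ?thesis
    using equiv_class_eq[OF equiv_seq_equiv] by (simp add: seq_class_def)
qed

text \<open>The tool for all later computations: one rule applied inside a path becomes an equality
  of fractions.\<close>

lemma cls_replacement:
  assumes "replacement C \<Sigma> u v" "path C \<Sigma> X (p @ u @ q) Y"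
  shows "cls X (p @ u @ q) Y = cls X (p @ v @ q) Y"
proof -
  have v: "path C \<Sigma> X (p @ v @ q) Y"
    using assms by (rule path_replacement_context)
  then have "((X, p @ u @ q, Y), (X, p @ v @ q, Y)) \<in> replace_step C \<Sigma>"
    using assms unfolding replace_step_def by blast
  then show ?thesis
    using v assms(2) by (auto simp: cls_eq_iff seq_equiv_def sequences_def)
qed

text \<open>Endpoints are constant on a class, by \<open>seq_equiv_context\<close> with empty lists
  on both sides; any member may then serve as the representative naming the class.\<close>

lemma mem_clsE:
  assumes "s \<in> cls X ls Y"
  obtains ms where "s = (X, ms, Y)" "path C \<Sigma> X ls Y" "path C \<Sigma> X ms Y" "cls X ms Y = cls X ls Y"
proof -
  from assms have eq: "((X, ls, Y), s) \<in> seq_equiv C \<Sigma>"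
    by (simp add: seq_class_def)
  then have path: "path C \<Sigma> X ls Y" "s \<in> sequences C \<Sigma>"
    by (auto simp: seq_equiv_def sequences_def)
  with eq seq_equiv_context[of X ls Y s X "[]" "[]" Y] obtain ms where "s = (X, ms, Y)"
    by (auto dest: path_in_Obj)
  with path eq show thesis
    using that by (metis cls_eq_iff sequences_def mem_Collect_eq case_prodD)
qed

lemma Dom_cls: "path C \<Sigma> X ls Y \<Longrightarrow> Dom L (cls X ls Y) = X"
  unfolding localization_def by (auto intro!: the_equality intro: cls_self elim: mem_clsE)

lemma Cod_cls: "path C \<Sigma> X ls Y \<Longrightarrow> Cod L (cls X ls Y) = Y"
  unfolding localization_def by (auto intro!: the_equality intro: cls_self elim: mem_clsE)

lemma Mor_localization: "Mor L = {cls X ls Y | X ls Y. path C \<Sigma> X ls Y}"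
  by (auto simp: localization_def fractions_def quotient_def sequences_def seq_class_def)

lemma Obj_localization: "Obj L = Obj C"
  by (simp add: localization_def)

lemma Ident_localization: "Ident L X = cls X [] X"
  by (simp add: localization_def)

lemma cls_in_Hom: "path C \<Sigma> X ls Y \<Longrightarrow> cls X ls Y \<in> Hom L X Y"
  by (auto simp: Hom_def Mor_localization Dom_cls Cod_cls)

lemma Hom_localizationE:
  assumes "F \<in> Hom L X Y"
  obtains ls where "F = cls X ls Y" "path C \<Sigma> X ls Y"
  using assms by (auto simp: Hom_def Mor_localization Dom_cls Cod_cls)

text \<open>The union defining the composite runs over all pairs of representatives. By the
  congruence every pair contributes the same class, and there is at least one pair, so the union is
  that class.\<close>

lemma Comp_cls:
  assumes "path C \<Sigma> X ls Y" "path C \<Sigma> Y ms Z"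
  shows "cls Y ms Z \<cdot>\<^bsub>L\<^esub> cls X ls Y = cls X (ls @ ms) Z"
proof -
  let ?conc = "\<lambda>s t. cls (fst s) (fst (snd s) @ fst (snd t)) (snd (snd t))"
  have const: "?conc s t = cls X (ls @ ms) Z" if "s \<in> cls X ls Y" "t \<in> cls Y ms Z" for s t
  proof -
    from that obtain ls' ms' where s: "s = (X, ls', Y)" and t: "t = (Y, ms', Z)"
      and l: "path C \<Sigma> X ls' Y" "cls X ls' Y = cls X ls Y"
      and m: "path C \<Sigma> Y ms' Z" "cls Y ms' Z = cls Y ms Z"
      by (elim mem_clsE) blast
    \<comment> \<open>The representatives are exchanged one at a time: first \<open>ls'\<close> for
      \<open>ls\<close> with \<open>ms'\<close> kept, then \<open>ms'\<close> for \<open>ms\<close>.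
      The empty lists only supply the missing side of \<open>cls_context\<close>.\<close>
    have "cls X ([] @ ls' @ ms') Z = cls X ([] @ ls @ ms') Z"
      using assms l m by (intro cls_context) (auto dest: path_in_Obj)
    also have "\<dots> = cls X (ls @ ms' @ []) Z"
      by simp
    also have "\<dots> = cls X (ls @ ms @ []) Z"
      using assms m by (intro cls_context) (auto dest: path_in_Obj)
    finally show ?thesis
      by (simp add: s t)
  qed
  have "cls Y ms Z \<cdot>\<^bsub>L\<^esub> cls X ls Y = (\<Union>s\<in>cls X ls Y. \<Union>t\<in>cls Y ms Z. ?conc s t)"
    by (simp add: localization_def case_prod_beta)
  also have "\<dots> = (\<Union>_\<in>cls X ls Y. \<Union>_\<in>cls Y ms Z. cls X (ls @ ms) Z)"
    by (intro SUP_cong refl const)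
  also have "\<dots> = cls X (ls @ ms) Z"
    using assms[THEN cls_self] by auto
  finally show ?thesis .
qed

text \<open>Once composition is concatenation of representatives, the unit and associativity laws
  are those of \<open>@\<close> on lists.\<close>

sublocale localization: category L
proof (standard, goal_cases)
  case (1 F)
  then show ?case
    by (auto simp: Mor_localization Dom_cls Obj_localization dest: path_in_Obj)
next
  case (2 F)
  then show ?case
    by (auto simp: Mor_localization Cod_cls Obj_localization dest: path_in_Obj)
next
  case (3 X)
  then show ?case
    by (simp add: Obj_localization Ident_localization cls_in_Hom)
next
  case (4 F X Y G Z)
  then obtain ls ms where "F = cls X ls Y" "path C \<Sigma> X ls Y" "G = cls Y ms Z" "path C \<Sigma> Y ms Z"
    by (elim Hom_localizationE)
  then show ?case
    by (auto simp: Comp_cls path_append intro!: cls_in_Hom)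
next
  case (5 F X Y)
  then show ?case
    by (elim Hom_localizationE) (use Comp_cls[of X "[]" X] path_in_Obj in \<open>auto simp: Ident_localization\<close>)
next
  case (6 F X Y)
  then show ?case
    by (elim Hom_localizationE) (use Comp_cls[of X _ Y "[]"] path_in_Obj in \<open>auto simp: Ident_localization\<close>)
next
  case (7 F W X G Y H Z)
  then obtain ls ms ns where "F = cls W ls X" "path C \<Sigma> W ls X" "G = cls X ms Y" "path C \<Sigma> X ms Y"
    "H = cls Y ns Z" "path C \<Sigma> Y ns Z"
    by (elim Hom_localizationE)
  moreover from this have "path C \<Sigma> W (ls @ ms) Y" "path C \<Sigma> X (ms @ ns) Z"
    by (auto simp: path_append)
  ultimately show ?case
    by (simp add: Comp_cls)
qed

section \<open>The functor into the localization and the invertibility of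
  \<open>\<Sigma>\<close>\<close>

lemma mor_class_Hom: "a \<in> Hom C X Y \<Longrightarrow> mor_class C \<Sigma> a = cls X [Arr a] Y"
  by (auto simp: mor_class_def Hom_def)

lemma mor_class_Ident:
  assumes "X \<in> Obj C"
  shows "mor_class C \<Sigma> (Ident C X) = Ident L X"
  using cls_replacement[OF drop_Ident[of X], of X "[]" "[]" X] assms
    mor_class_Hom[OF Ident_in_Hom[OF assms]] path_Arr[OF Ident_in_Hom[OF assms]]
  by (simp add: Ident_localization)

lemma mor_class_Comp:
  assumes "f \<in> Hom C X Y" "g \<in> Hom C Y Z"
  shows "mor_class C \<Sigma> (g \<cdot> f) = mor_class C \<Sigma> g \<cdot>\<^bsub>L\<^esub> mor_class C \<Sigma> f"
proof -
  have "mor_class C \<Sigma> g \<cdot>\<^bsub>L\<^esub> mor_class C \<Sigma> f = cls X [Arr f, Arr g] Z"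
    using assms Comp_cls[OF path_Arr path_Arr] by (simp add: mor_class_Hom)
  also have "\<dots> = cls X [Arr (g \<cdot> f)] Z"
    using cls_replacement[OF compose[of f C g \<Sigma>], of X "[]" "[]" Z] assms
    by (auto simp: Hom_def lines_def dest: Cod_in_Obj)
  finally show ?thesis
    using Comp_in_Hom[OF assms] by (simp add: mor_class_Hom)
qed

text \<open>The fractions of \<open>d\<close> and of its formal inverse line are mutually inverse,
  so \<open>d\<close> can be moved across the equation. The direction from left to right will give
  uniqueness, the other one existence.\<close>

lemma mor_class_Comp_eq_iff:
  assumes "d \<in> \<Sigma>" "b \<in> Hom L X (Dom C d)" "f \<in> Hom L X (Cod C d)"
  shows "mor_class C \<Sigma> d \<cdot>\<^bsub>L\<^esub> b = f \<longleftrightarrow> b = cls (Cod C d) [Inv d] (Dom C d) \<cdot>\<^bsub>L\<^esub> f"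
proof -
  let ?d = "mor_class C \<Sigma> d" and ?l = "cls (Cod C d) [Inv d] (Dom C d)"
  have pl: "path C \<Sigma> (Cod C d) [Inv d] (Dom C d)"
    by (rule path_Inv) fact
  have pd: "path C \<Sigma> (Dom C d) [Arr d] (Cod C d)"
    using assms(1) Sigma_Mor by (intro path_Arr) (auto simp: Hom_def)
  have l: "?l \<in> Hom L (Cod C d) (Dom C d)" and d: "?d \<in> Hom L (Dom C d) (Cod C d)"
    using pl pd by (auto simp: mor_class_def intro: cls_in_Hom)
  have "path C \<Sigma> (Dom C d) [Arr d, Inv d] (Dom C d)" "path C \<Sigma> (Cod C d) [Inv d, Arr d] (Cod C d)"
    using pl pd by auto
  \<comment> \<open>Lists are in order of traversal, whereas composition is read from right to left:
    \<open>?l\<close> after \<open>?d\<close> is the list \<open>[Arr d, Inv d]\<close>, to which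
    \<open>cancel_right\<close> applies.\<close>
  then have "?l \<cdot>\<^bsub>L\<^esub> ?d = Ident L (Dom C d)" "?d \<cdot>\<^bsub>L\<^esub> ?l = Ident L (Cod C d)"
    using Comp_cls[OF pd pl] Comp_cls[OF pl pd]
      cls_replacement[OF cancel_right[OF assms(1)], of "Dom C d" "[]" "[]" "Dom C d"]
      cls_replacement[OF cancel_left[OF assms(1)], of "Cod C d" "[]" "[]" "Cod C d"]
    by (simp_all add: mor_class_def Ident_localization)
  then show ?thesis
    using localization.Comp_assoc[OF assms(2) d l] localization.Comp_assoc[OF assms(3) l d]
      localization.Ident_Comp[OF assms(2)] localization.Ident_Comp[OF assms(3)]
    by metis
qed

end

section \<open>The dilatation is a category\<close>

locale dilating = category C for C :: "('o, 'm) cat" (structure) +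
  fixes I :: "'i set" and N :: "'i \<Rightarrow> 'm set" and d :: "'i \<Rightarrow> 'm"
  assumes center: "center C I N d"

sublocale dilating \<subseteq> localizing C "d ` I"
  using center by unfold_locales (auto simp: center_def)

context dilating
begin

abbreviation zigzag :: "('i \<times> 'm) list \<Rightarrow> 'm line list" where
  "zigzag ps \<equiv> concat (map (\<lambda>(i, n). [Arr n, Inv (d i)]) ps)"

abbreviation D :: "('o, ('o, 'm) seq set) cat" where
  "D \<equiv> dilatation C I N d"

section \<open>Morphisms of the dilatation\<close>

lemma dilatation_eq: "D = L\<lparr>Mor := Mor D\<rparr>"
  by (simp add: dilatation_def)

text \<open>A class containing a center sequence is the class of that sequence, so every morphism
  can be named by a representative of the special form.\<close>

lemma Mor_dilatation:
  "Mor D = {cls X (zigzag ps @ [Arr a]) Y | X ps a Y.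
    set ps \<subseteq> (SIGMA i:I. N i) \<and> path C (d ` I) X (zigzag ps @ [Arr a]) Y}"
proof -
  have "Mor D = {F \<in> Mor L. \<exists>s\<in>F. s \<in> center_sequences C I N d}"
    by (simp add: dilatation_def localization_def)
  also have "\<dots> = {cls X (zigzag ps @ [Arr a]) Y | X ps a Y.
    set ps \<subseteq> (SIGMA i:I. N i) \<and> path C (d ` I) X (zigzag ps @ [Arr a]) Y}" (is "?A = ?B")
  proof (intro equalityI subsetI)
    fix F assume "F \<in> ?A"
    then obtain X ps a Y X' ls Y' where "F = cls X' ls Y'" "set ps \<subseteq> (SIGMA i:I. N i)"
      "(X, zigzag ps @ [Arr a], Y) \<in> F"
      by (auto simp: Mor_localization center_sequences_def)
    then show "F \<in> ?B"
      by (auto elim!: mem_clsE) metis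
  next
    fix F assume "F \<in> ?B"
    then obtain X ps a Y where F: "F = cls X (zigzag ps @ [Arr a]) Y" "set ps \<subseteq> (SIGMA i:I. N i)"
      "path C (d ` I) X (zigzag ps @ [Arr a]) Y"
      by blast
    moreover from this have "a \<in> Mor C"
      by (auto simp: path_append lines_def)
    ultimately show "F \<in> ?A"
      using cls_self[OF F(3)]
      by (auto simp: Mor_localization center_sequences_def sequences_def
          intro!: bexI[OF _ cls_self[OF F(3)]])
  qed
  finally show ?thesis .
qed

section \<open>Identities and composites in the dilatation\<close>

lemma zigzag_in_Mor:
  "set ps \<subseteq> (SIGMA i:I. N i) \<Longrightarrow> path C (d ` I) X (zigzag ps @ [Arr a]) Y
    \<Longrightarrow> cls X (zigzag ps @ [Arr a]) Y \<in> Mor D"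
  unfolding Mor_dilatation by blast

lemma Mor_dilatation_subset: "Mor D \<subseteq> Mor L"
  by (auto simp: dilatation_def localization_def)

lemma mor_class_in_Mor:
  assumes "a \<in> Mor C"
  shows "mor_class C (d ` I) a \<in> Mor D"
proof -
  \<comment> \<open>This is the case \<open>k = 0\<close> of the special form: no pairs, only the
    trailing arrow.\<close>
  have "path C (d ` I) (Dom C a) (zigzag [] @ [Arr a]) (Cod C a)"
    using path_Arr[of a] assms by (simp add: Hom_def)
  then have "cls (Dom C a) (zigzag [] @ [Arr a]) (Cod C a) \<in> Mor D"
    by (intro zigzag_in_Mor) simp
  then show ?thesis
    by (simp add: mor_class_def)
qed

text \<open>Only the inner arrow \<open>a\<close> violates the special form. The line after it is
  again an arrow: \<open>b\<close> if \<open>qs\<close> is empty, otherwise the first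
  \<open>n\<close> of \<open>qs\<close>. Composing the two restores the form.\<close>

lemma cls_zigzag_append:
  assumes ps: "set ps \<subseteq> (SIGMA i:I. N i)" and qs: "set qs \<subseteq> (SIGMA i:I. N i)"
    and path: "path C (d ` I) X ((zigzag ps @ [Arr a]) @ zigzag qs @ [Arr b]) Z"
  shows "cls X ((zigzag ps @ [Arr a]) @ zigzag qs @ [Arr b]) Z \<in> Mor D"
proof -
  \<comment> \<open>Both cases use this merging of \<open>a\<close> with the next arrow
    \<open>c\<close>; \<open>r\<close> stands for the remaining lines.\<close>
  have shorten: "cls X (zigzag ps @ [Arr a, Arr c] @ r) Z = cls X (zigzag ps @ [Arr (c \<cdot> a)] @ r) Z"
    "path C (d ` I) X (zigzag ps @ [Arr (c \<cdot> a)] @ r) Z" "a \<in> Mor C" "Cod C a = Dom C c"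
    if p: "path C (d ` I) X (zigzag ps @ [Arr a, Arr c] @ r) Z" for c r
  proof -
    from p show ac: "a \<in> Mor C" "Cod C a = Dom C c"
      by (auto simp: path_append lines_def)
    from p have "c \<in> Mor C"
      by (auto simp: path_append lines_def)
    then have rep: "replacement C (d ` I) [Arr a, Arr c] [Arr (c \<cdot> a)]"
      using ac by (intro compose)
    then show "cls X (zigzag ps @ [Arr a, Arr c] @ r) Z = cls X (zigzag ps @ [Arr (c \<cdot> a)] @ r) Z"
      using p by (rule cls_replacement)
    show "path C (d ` I) X (zigzag ps @ [Arr (c \<cdot> a)] @ r) Z"
      using rep p by (rule path_replacement_context)
  qed
  show ?thesis
  proof (cases qs)
    case Nil
    then have p: "path C (d ` I) X (zigzag ps @ [Arr a, Arr b] @ []) Z"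
      using path by simp
    then have "cls X (zigzag ps @ [Arr (b \<cdot> a)]) Z \<in> Mor D"
      using shorten(2)[OF p] ps by (intro zigzag_in_Mor) simp_all
    then show ?thesis
      using shorten(1)[OF p] Nil by simp
  next
    case (Cons q qs')
    obtain i n where q: "q = (i, n)"
      by fastforce
    \<comment> \<open>In \<open>?ps\<close> the arrow \<open>a\<close> has been absorbed into the
      first pair of \<open>qs\<close>; the trailing arrow is now \<open>b\<close>.\<close>
    let ?r = "Inv (d i) # zigzag qs' @ [Arr b]" and ?ps = "ps @ (i, n \<cdot> a) # qs'"
    have p: "path C (d ` I) X (zigzag ps @ [Arr a, Arr n] @ ?r) Z"
      using path Cons q by simp
    have "i \<in> I" "n \<in> N i"
      using qs Cons q by auto
    \<comment> \<open>Stability of the sieve under precomposition enters here.\<close>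
    then have "n \<cdot> a \<in> N i"
      using center shorten(3,4)[OF p] by (auto simp: center_def sieve_over_def sieve_def)
    then have "set ?ps \<subseteq> (SIGMA i:I. N i)"
      using ps qs Cons \<open>i \<in> I\<close> by auto
    moreover have "path C (d ` I) X (zigzag ?ps @ [Arr b]) Z"
      using shorten(2)[OF p] by simp
    ultimately have "cls X (zigzag ?ps @ [Arr b]) Z \<in> Mor D"
      by (rule zigzag_in_Mor)
    then show ?thesis
      using shorten(1)[OF p] Cons q by simp
  qed
qed

lemma Comp_in_Mor:
  assumes "F \<in> Mor D" "G \<in> Mor D" "Cod L F = Dom L G"
  shows "G \<cdot>\<^bsub>L\<^esub> F \<in> Mor D"
proof -
  from assms(1) obtain X ps a Y where
    F: "F = cls X (zigzag ps @ [Arr a]) Y" "set ps \<subseteq> (SIGMA i:I. N i)"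
      "path C (d ` I) X (zigzag ps @ [Arr a]) Y"
    unfolding Mor_dilatation by blast
  from assms(2) obtain Y' qs b Z where
    G: "G = cls Y' (zigzag qs @ [Arr b]) Z" "set qs \<subseteq> (SIGMA i:I. N i)"
      "path C (d ` I) Y' (zigzag qs @ [Arr b]) Z"
    unfolding Mor_dilatation by blast
  have "Y' = Y"
    using assms(3) F G by (simp add: Dom_cls Cod_cls)
  then have "G \<cdot>\<^bsub>L\<^esub> F = cls X ((zigzag ps @ [Arr a]) @ zigzag qs @ [Arr b]) Z"
    using F G by (simp only: Comp_cls)
  moreover have "path C (d ` I) X ((zigzag ps @ [Arr a]) @ zigzag qs @ [Arr b]) Z"
    using F(3) G(3) \<open>Y' = Y\<close> path_append by blast
  ultimately show ?thesis
    using cls_zigzag_append[OF F(2) G(2)] by simp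
qed

text \<open>The identity fraction is represented by the empty sequence, which is not of the special
  form; it is also the class of the single arrow \<open>Ident C X\<close>, which is.\<close>

lemma category_dilatation: "category D"
proof -
  have "Ident L X \<in> Mor D" if "X \<in> Obj L" for X
  proof -
    from that have "X \<in> Obj C"
      by (simp add: Obj_localization)
    then have "mor_class C (d ` I) (Ident C X) \<in> Mor D"
      using Ident_in_Hom by (intro mor_class_in_Mor) (auto simp: Hom_def)
    with \<open>X \<in> Obj C\<close> show ?thesis
      by (simp add: mor_class_Ident)
  qed
  then have "category (L\<lparr>Mor := Mor D\<rparr>)"
    using Comp_in_Mor Mor_dilatation_subset localization.category_axioms
    by (intro category_if_contains_Ident_and_Comp)
  then show ?thesis
    using dilatation_eq by simp
qed

section \<open>The canonical functor and the factorization through \<open>d i\<close>\<close>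

lemma dilatation_simps:
  "Obj D = Obj C" "Ident D = Ident L" "Comp D = Comp L"
  "Hom D X Y = Hom L X Y \<inter> Mor D"
  using Mor_dilatation_subset by (auto simp: dilatation_def localization_def Hom_def)

lemma cat_functor_mor_class: "cat_functor C D (\<lambda>X. X) (mor_class C (d ` I))"
proof (intro cat_functor.intro category_axioms category_dilatation cat_functor_axioms.intro)
  fix f X Y assume "f \<in> Hom C X Y"
  then show "mor_class C (d ` I) f \<in> Hom D X Y"
    using mor_class_in_Mor[of f] cls_in_Hom[OF path_Arr, of f X Y]
    by (simp add: dilatation_simps mor_class_Hom) (simp add: Hom_def)
qed (auto simp: dilatation_simps mor_class_Ident mor_class_Comp)

text \<open>The sequence of \<open>n\<close> and the inverse line of \<open>d i\<close> lacks the
  trailing arrow of a center sequence. Appending the identity of \<open>Dom C (d i)\<close> supplies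
  one without changing the class.\<close>

lemma cls_Arr_Inv_in_Hom:
  assumes "i \<in> I" "n \<in> N i"
  shows "cls (Dom C n) [Arr n, Inv (d i)] (Dom C (d i)) \<in> Hom D (Dom C n) (Dom C (d i))"
proof -
  let ?X = "Dom C n" and ?Y = "Dom C (d i)"
  have dn: "d i \<in> Mor C" "n \<in> Mor C" "Cod C n = Cod C (d i)"
    using center assms by (auto simp: center_def sieve_over_def sieve_def)
  then have id: "Ident C ?Y \<in> Hom C ?Y ?Y" "?Y \<in> Obj C"
    using Dom_in_Obj Ident_in_Hom by blast+
  have p: "path C (d ` I) ?X [Arr n, Inv (d i)] ?Y"
    using dn id assms by (auto simp: lines_def)
  have q: "path C (d ` I) ?X (zigzag [(i, n)] @ [Arr (Ident C ?Y)]) ?Y"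
    using dn id assms Cod_in_Obj by (auto simp: lines_def Hom_def)
  have "cls ?X (zigzag [(i, n)] @ [Arr (Ident C ?Y)]) ?Y = cls ?X [Arr n, Inv (d i)] ?Y"
    using cls_replacement[OF drop_Ident[OF id(2)], of ?X "[Arr n, Inv (d i)]" "[]" ?Y] q id(2) by simp
  then show ?thesis
    using zigzag_in_Mor[OF _ q] cls_in_Hom[OF p] assms by (simp add: dilatation_simps)
qed

text \<open>The hom-sets of the dilatation lie in those of the localization and composition is the
  same, so the equation can be solved there; its solution is the fraction of \<open>n\<close>
  followed by the inverse line, that is, the concatenated two-line sequence.\<close>

lemma mor_class_Comp_eq_mor_class_iff:
  assumes "i \<in> I" "n \<in> N i" "b \<in> Hom D (Dom C n) (Dom C (d i))"
  shows "mor_class C (d ` I) (d i) \<cdot>\<^bsub>D\<^esub> b = mor_class C (d ` I) n \<longleftrightarrow>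
    b = cls (Dom C n) [Arr n, Inv (d i)] (Dom C (d i))"
proof -
  have n: "n \<in> Hom C (Dom C n) (Cod C (d i))"
    using center assms by (auto simp: center_def sieve_over_def sieve_def Hom_def)
  have "cls (Cod C (d i)) [Inv (d i)] (Dom C (d i)) \<cdot>\<^bsub>L\<^esub> mor_class C (d ` I) n
      = cls (Dom C n) [Arr n, Inv (d i)] (Dom C (d i))"
    using Comp_cls[OF path_Arr[OF n] path_Inv] assms(1) by (simp add: mor_class_Hom[OF n])
  moreover have "mor_class C (d ` I) n \<in> Hom L (Dom C n) (Cod C (d i))"
    using cls_in_Hom[OF path_Arr[OF n]] by (simp add: mor_class_Hom[OF n])
  ultimately show ?thesis
    using mor_class_Comp_eq_iff[of "d i" b "Dom C n" "mor_class C (d ` I) n"] assms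
    by (simp add: dilatation_simps)
qed

end

theorem proposition3p1:
  fixes C :: "('o, 'm) cat" and I :: "'i set" and N :: "'i \<Rightarrow> 'm set" and d :: "'i \<Rightarrow> 'm"
  assumes "category C" and "center C I N d"
  shows "cat_functor C (dilatation C I N d) (\<lambda>X. X) (mor_class C (d ` I)) \<and>
    (\<forall>i\<in>I. \<forall>n\<in>N i.
      (\<exists>!b. b \<in> Hom (dilatation C I N d) (Dom C n) (Dom C (d i)) \<and>
        mor_class C (d ` I) (d i) \<cdot>\<^bsub>dilatation C I N d\<^esub> b = mor_class C (d ` I) n) \<and>
      (\<forall>b. b \<in> Hom (dilatation C I N d) (Dom C n) (Dom C (d i)) \<and>
        mor_class C (d ` I) (d i) \<cdot>\<^bsub>dilatation C I N d\<^esub> b = mor_class C (d ` I) n \<longrightarrow>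
        b = seq_class C (d ` I) (Dom C n, [Arr n, Inv (d i)], Dom C (d i))))"
proof -
  interpret dilating C I N d
    using assms by (simp add: dilating_def dilating_axioms_def)
  show ?thesis
  proof (intro conjI ballI)
    show "cat_functor C D (\<lambda>X. X) (mor_class C (d ` I))"
      by (rule cat_functor_mor_class)
  next
    fix i n
    assume "i \<in> I" "n \<in> N i"
    note in_Hom = cls_Arr_Inv_in_Hom[OF this] and iff = mor_class_Comp_eq_mor_class_iff[OF this]
    show "\<exists>!b. b \<in> Hom D (Dom C n) (Dom C (d i)) \<and>
        mor_class C (d ` I) (d i) \<cdot>\<^bsub>D\<^esub> b = mor_class C (d ` I) n"
      \<comment> \<open>Existence reads \<open>iff\<close> from right to left at the explicit
        fraction, which \<open>in_Hom\<close> places in the dilatation; uniqueness reads it from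
        left to right.\<close>
      using in_Hom iff by metis
    show "\<forall>b. b \<in> Hom D (Dom C n) (Dom C (d i)) \<and>
        mor_class C (d ` I) (d i) \<cdot>\<^bsub>D\<^esub> b = mor_class C (d ` I) n \<longrightarrow>
        b = cls (Dom C n) [Arr n, Inv (d i)] (Dom C (d i))"
      using iff by metis
  qed
qed

end
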